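(* Let $\Gamma$ be a discrete group. (1) The value $\mathrm{rk}_{BC}(\Gamma)$ equals the supremum of the ranks of finitely generated free abelian subgroups $A$ of $\Gamma$ for which the index of $\mathrm{FC}_\Gamma(A)$ in $\Gamma$ is finite. (2) If $\Gamma$ is a finitely generated group, then $\mathrm{rk}_{BC}(\Gamma)$ is the supremum of the ranks of finitely generated free abelian subgroups $A$ of $\Gamma$ which are contained in the FC-center of $\Gamma$.
   Context: For a group $\Gamma$, a subgroup $H\leq\Gamma$ and $\gamma\in\Gamma$, write $\gamma^H=\{h\gamma h^{-1}\mid h\in H\}$. The FC-centralizer of $H$ in $\Gamma$ is the subgroup $\mathrm{FC}_\Gamma(H)=\{\gamma\in\Gamma\mid \gamma^H\text{ is finite}\}$, and the FC-center of $\Gamma$ is $\mathrm{FC}_\Gamma(\Gamma)$. For a topological group $G$ and a subgroup $H\leq G$, the BC-centralizer of $H$ in $G$ is the subgroup $\mathrm{BC}_G(H)=\{g\in G\mid g^H\text{ is relatively compact in } G\}$. For $G$ a totally disconnected locally compact group, a closed subgroup $A\leq G$ is thin on $G$ if $A$ normalizes some compact open subgroup of $G$ and $\mathrm{BC}_G(A)$ is a finite index open subgroup of $G$. A locally compact group is regionally compact if every finite subset generates a relatively compact subgroup. Every locally compact group $A$ has a unique largest regionally compact normal subgroup, the regionally compact radical, denoted $\mathrm{Rad}_{\mathcal{RC}}(A)$. The thin rank $\mathrm{rk}_t(A)$ of a closed subgroup $A$ that is thin on $G$ is the supremum of the ranks of free abelian subgroups of $A/\mathrm{Rad}_{\mathcal{RC}}(A)$.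 The bounded conjugacy rank $\mathrm{rk}_{BC}(G)\in\{0,1,2,\dots\}\cup\{\infty\}$ of a totally disconnected locally compact group $G$ is the supremum of $\mathrm{rk}_t(A)$ as $A$ ranges over all compactly generated closed subgroups of $G$ that are thin on $G$. A discrete group is regarded as a totally disconnected locally compact group. *)

theory Defs
  imports
    "HOL-Library.Extended_Nat"
    "HOL-Algebra.Group_Action"
    "HOL-Algebra.Generated_Groups"
    "HOL-Algebra.Free_Abelian_Groups"
    "HOL-Analysis.Abstract_Topological_Spaces"
begin

section \<open>Totally disconnected locally compact groups\<close>

locale topological_group = group G for G (structure) +
  fixes T :: "'a topology"
  assumes topspace_eq: "topspace T = carrier G"
    and continuous_mult: "continuous_map (prod_topology T T) T (\<lambda>(x, y). x \<otimes> y)"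
    and continuous_inv: "continuous_map T T (\<lambda>x. inv x)"

locale locally_compact_group = topological_group +
  assumes Hausdorff: "Hausdorff_space T"
    and locally_compact: "locally_compact_space T"

locale tdlc_group = locally_compact_group +
  assumes totally_disconnected: "connectedin T S \<Longrightarrow> S \<noteq> {} \<Longrightarrow> \<exists>x. S = {x}"

text \<open>
  A subgroup \<open>H\<close> of \<open>(G, T)\<close> is turned into a topological group of its own as
  \<open>(G\<lparr>carrier := H\<rparr>, subtopology T H)\<close>.
\<close>

lemma tdlc_group_discrete_topology:
  assumes "group G"
  shows "tdlc_group G (discrete_topology (carrier G))"
proof -
  interpret group G by fact
  show ?thesis
  proof (unfold_locales)
    show "continuous_map (prod_topology (discrete_topology (carrier G)) (discrete_topology (carrier G)))
            (discrete_topology (carrier G)) (\<lambda>(x, y). x \<otimes>\<^bsub>G\<^esub> y)"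
      by (auto simp flip: prod_topology_discrete_topology)
    show "locally_compact_space (discrete_topology (carrier G))"
      unfolding locally_compact_space_def
    proof
      fix x assume "x \<in> topspace (discrete_topology (carrier G))"
      then show "\<exists>U K. openin (discrete_topology (carrier G)) U \<and>
                  compactin (discrete_topology (carrier G)) K \<and> x \<in> U \<and> U \<subseteq> K"
        by (intro exI[of _ "{x}"]) (simp add: compactin_discrete_topology)
    qed
    show "\<exists>x. S = {x}" if "connectedin (discrete_topology (carrier G)) S" "S \<noteq> {}" for S
      using that unfolding connectedin_discrete_topology by blast
  qed auto
qed

definition relatively_compactin :: "'a topology \<Rightarrow> 'a set \<Rightarrow> bool" where
  "relatively_compactin T S \<longleftrightarrow> S \<subseteq> topspace T \<and> compactin T (T closure_of S)"

definition compactly_generated :: "('a, 'b) monoid_scheme \<Rightarrow> 'a topology \<Rightarrow> bool" where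
  "compactly_generated G T \<longleftrightarrow> (\<exists>K. compactin T K \<and> generate G K = carrier G)"

definition finitely_generated :: "('a, 'b) monoid_scheme \<Rightarrow> bool" where
  "finitely_generated G \<longleftrightarrow> (\<exists>S. finite S \<and> S \<subseteq> carrier G \<and> generate G S = carrier G)"

section \<open>Free abelian subgroups and their ranks\<close>

text \<open>
  The basis \<open>S\<close> may be taken in the type of the group elements without loss of generality,
  because any basis of a free abelian group can be identified with a subset of its carrier. The
  rank is unique by the lemma \<open>isomorphic_free_Abelian_groups\<close>.
\<close>

definition free_abelian_of_rank :: "('a, 'b) monoid_scheme \<Rightarrow> enat \<Rightarrow> bool" where
  "free_abelian_of_rank G r \<longleftrightarrow>
    (\<exists>S :: 'a set. G \<cong> free_Abelian_group S \<and> r = (if finite S then enat (card S) else \<infinity>))"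

section \<open>Bounded conjugacy\<close>

definition conjugates :: "('a, 'b) monoid_scheme \<Rightarrow> 'a set \<Rightarrow> 'a \<Rightarrow> 'a set" where
  "conjugates G H g = (\<lambda>h. h \<otimes>\<^bsub>G\<^esub> g \<otimes>\<^bsub>G\<^esub> inv\<^bsub>G\<^esub> h) ` H"

definition FC_centralizer :: "('a, 'b) monoid_scheme \<Rightarrow> 'a set \<Rightarrow> 'a set" where
  "FC_centralizer G H = {g \<in> carrier G. finite (conjugates G H g)}"

definition FC_center :: "('a, 'b) monoid_scheme \<Rightarrow> 'a set" where
  "FC_center G = FC_centralizer G (carrier G)"

definition BC_centralizer :: "('a, 'b) monoid_scheme \<Rightarrow> 'a topology \<Rightarrow> 'a set \<Rightarrow> 'a set" where
  "BC_centralizer G T H = {g \<in> carrier G. relatively_compactin T (conjugates G H g)}"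

definition finite_index :: "('a, 'b) monoid_scheme \<Rightarrow> 'a set \<Rightarrow> bool" where
  "finite_index G H \<longleftrightarrow> subgroup H G \<and> finite (rcosets\<^bsub>G\<^esub> H)"

definition thin_on :: "('a, 'b) monoid_scheme \<Rightarrow> 'a topology \<Rightarrow> 'a set \<Rightarrow> bool" where
  "thin_on G T A \<longleftrightarrow>
    subgroup A G \<and> closedin T A \<and>
    (\<exists>U. subgroup U G \<and> compactin T U \<and> openin T U \<and> A \<subseteq> normalizer G U) \<and>
    finite_index G (BC_centralizer G T A) \<and> openin T (BC_centralizer G T A)"

section \<open>The regionally compact radical and the ranks\<close>

definition regionally_compact :: "('a, 'b) monoid_scheme \<Rightarrow> 'a topology \<Rightarrow> bool" where
  "regionally_compact G T \<longleftrightarrow>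
    locally_compact_group G T \<and>
    (\<forall>F. finite F \<and> F \<subseteq> carrier G \<longrightarrow> relatively_compactin T (generate G F))"

text \<open>
  \<^const>\<open>regionally_compact\<close> includes local compactness in the subspace topology, so all the
  competing normal subgroups are closed.
\<close>

definition Rad_RC :: "('a, 'b) monoid_scheme \<Rightarrow> 'a topology \<Rightarrow> 'a set" where
  "Rad_RC G T =
    (GREATEST N. N \<lhd> G \<and> regionally_compact (G\<lparr>carrier := N\<rparr>) (subtopology T N))"

definition thin_rank :: "('a, 'b) monoid_scheme \<Rightarrow> 'a topology \<Rightarrow> 'a set \<Rightarrow> enat" where
  "thin_rank G T A =
    (let G\<^sub>A = G\<lparr>carrier := A\<rparr>; Q = G\<^sub>A Mod Rad_RC G\<^sub>A (subtopology T A)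
     in Sup {r. \<exists>B. subgroup B Q \<and> free_abelian_of_rank (Q\<lparr>carrier := B\<rparr>) r})"

definition BC_rank :: "('a, 'b) monoid_scheme \<Rightarrow> 'a topology \<Rightarrow> enat" where
  "BC_rank G T =
    Sup {thin_rank G T A | A.
      thin_on G T A \<and> compactly_generated (G\<lparr>carrier := A\<rparr>) (subtopology T A)}"

end

theory Submission
  imports Defs "HOL-Algebra.SndIsomorphismGrp"
begin

text \<open>
  For a discrete group, thin subgroups are the subgroups \<open>A\<close> whose FC-centralizer has finite index,
  and the regionally compact radical of \<open>A\<close> is its locally finite radical. Lift a basis of a free
  abelian subgroup of finite rank of the quotient of \<open>A\<close> by its radical to elements of \<open>A\<close>. These
  have powers in the FC-centralizer of \<open>A\<close>, and further powers commute with each other; their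
  images being independent, they generate a free abelian subgroup of \<open>A\<close> of the same rank.
  Conversely, the locally finite radical of a free abelian group is trivial. If \<open>\<Gamma>\<close> is finitely
  generated, the FC-centralizer of \<open>A\<close> contains a finitely generated subgroup of finite index, which
  is centralized by suitable powers of a basis of \<open>A\<close>; hence these powers lie in the FC-center.
\<close>

section \<open>Commuting powers and subgroups of finite index\<close>

text \<open>The product of the individual exponents works for all indices at once, because each
  \<open>P i\<close> is stable under passing to multiples.\<close>

lemma ex_uniform_exponent:
  fixes P :: "'i \<Rightarrow> nat \<Rightarrow> bool"
  assumes "finite I"
    and "\<And>i. i \<in> I \<Longrightarrow> \<exists>k>0. P i k"
    and "\<And>i k m. i \<in> I \<Longrightarrow> P i k \<Longrightarrow> P i (k * m)"
  shows "\<exists>K>0. \<forall>i\<in>I. P i K"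
  using assms
proof (induction I rule: finite_induct)
  case empty
  show ?case by auto
next
  case (insert i I)
  then obtain K k where "K > 0" "\<forall>i\<in>I. P i K" "k > 0" "P i k"
    by (metis insertCI)
  then have "k * K > 0" "\<forall>j\<in>insert i I. P j (k * K)"
    using insert.prems(2) by (auto simp: mult.commute[of k K]) (metis mult.commute)
  then show ?case by blast
qed

text \<open>Pigeonhole principle. The indices come out ordered, so that \<open>j - i\<close> can
  serve as a positive exponent.\<close>

lemma ex_less_same_image:
  fixes f :: "nat \<Rightarrow> 'a"
  assumes "finite S" "\<And>i. f i \<in> S"
  obtains i j where "i < j" "f i = f j"
proof -
  have "\<not> inj f"
    using assms by (metis finite_imageD finite_subset image_subsetI infinite_UNIV_nat)
  then obtain i j where "i \<noteq> j" "f i = f j"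
    by (auto simp: inj_def)
  then show thesis
    using that by (metis linorder_neqE_nat)
qed

context group
begin

lemma commute_iff_conj_fix:
  assumes "x \<in> carrier G" "y \<in> carrier G"
  shows "x \<otimes> y = y \<otimes> x \<longleftrightarrow> x \<otimes> y \<otimes> inv x = y"
  using assms by (metis inv_closed inv_solve_right m_closed)

lemma subgroup_nat_pow_closed:
  "subgroup H G \<Longrightarrow> x \<in> H \<Longrightarrow> x [^] (n::nat) \<in> H"
  by (induction n) (auto simp: subgroup.m_closed subgroup.one_closed)

text \<open>All powers of \<open>x\<close> lie in \<open>H\<close>, so they conjugate
  \<open>g\<close> to finitely many elements only. If \<open>x [^] i\<close> and
  \<open>x [^] j\<close> give the same conjugate, then \<open>x [^] (j - i)\<close> centralizes
  \<open>g\<close>.\<close>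

lemma finite_conjugates_pow_commutes:
  assumes "finite (conjugates G H g)" "g \<in> carrier G" "x \<in> H" "subgroup H G"
  shows "\<exists>k>0. x [^] (k::nat) \<otimes> g = g \<otimes> x [^] k"
proof -
  have x: "x \<in> carrier G"
    using subgroup.mem_carrier[OF assms(4,3)] .
  have pow: "x [^] k \<in> H" for k :: nat
    using subgroup_nat_pow_closed[OF assms(4,3)] .
  have "x [^] k \<otimes> g \<otimes> inv (x [^] k) \<in> conjugates G H g" for k :: nat
    using pow[of k] by (simp add: conjugates_def)
  then obtain i j :: nat where ij: "i < j"
    "x [^] i \<otimes> g \<otimes> inv (x [^] i) = x [^] j \<otimes> g \<otimes> inv (x [^] j)"
    by (rule ex_less_same_image[OF assms(1), of "\<lambda>k. x [^] k \<otimes> g \<otimes> inv (x [^] k)"])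
  have j: "x [^] j = x [^] i \<otimes> x [^] (j - i)"
    using ij(1) x by (simp add: nat_pow_mult)
  define c d where "c = x [^] i" and "d = x [^] (j - i)"
  have cd: "c \<in> carrier G" "d \<in> carrier G" "x [^] j = c \<otimes> d"
    using x j by (simp_all add: c_def d_def)
  have "c \<otimes> g \<otimes> inv c = c \<otimes> d \<otimes> g \<otimes> inv (c \<otimes> d)"
    using ij(2) cd(3) by (simp add: c_def)
  also have "\<dots> = c \<otimes> (d \<otimes> g \<otimes> inv d) \<otimes> inv c"
    using cd(1,2) assms(2) by (simp add: m_assoc inv_mult_group)
  finally have "d \<otimes> g \<otimes> inv d = g"
    using cd(1,2) assms(2) by simp
  then show ?thesis
    using ij(1) cd(2) assms(2) commute_iff_conj_fix[of d g] unfolding d_def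
    by (intro exI[of _ "j - i"]) simp
qed

text \<open>Two powers of \<open>x\<close> lie in the same right coset of \<open>H\<close>, and
  their quotient is a positive power of \<open>x\<close> in \<open>H\<close>.\<close>

lemma finite_index_pow_mem:
  assumes "finite_index G H" "x \<in> carrier G"
  shows "\<exists>k>0. x [^] (k::nat) \<in> H"
proof -
  have H: "subgroup H G" and fin: "finite (rcosets H)"
    using assms by (auto simp: finite_index_def)
  have "H #> x [^] k \<in> rcosets H" for k :: nat
    using assms H by (intro rcosetsI) (auto simp: subgroup.subset)
  then obtain i j :: nat where ij: "i < j" "H #> x [^] i = H #> x [^] j"
    by (rule ex_less_same_image[OF fin, of "\<lambda>k. H #> x [^] k"])
  then have "x [^] j \<in> H #> x [^] i"
    using repr_independenceD[OF H] assms(2) by simp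
  then have "x [^] j \<otimes> inv (x [^] i) \<in> H"
    using subgroup.rcos_module_imp[OF H group_axioms] assms(2) by simp
  moreover have "x [^] j = x [^] (j - i) \<otimes> x [^] i"
    using ij(1) assms(2) by (simp add: nat_pow_mult)
  ultimately have "x [^] (j - i) \<in> H"
    using assms(2) by (simp add: m_assoc)
  then show ?thesis
    using ij(1) by (metis zero_less_diff)
qed

text \<open>The last hypothesis puts each fibre of \<open>v\<close> into a single right coset, so
  there are at most as many cosets as values of \<open>v\<close>.\<close>

lemma finite_indexI:
  assumes "subgroup H G" "finite (v ` carrier G)"
    and "\<And>x y. x \<in> carrier G \<Longrightarrow> y \<in> carrier G \<Longrightarrow> v x = v y \<Longrightarrow> y \<otimes> inv x \<in> H"
  shows "finite_index G H"
proof -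
  have eq: "H #> x = H #> y" if "x \<in> carrier G" "y \<in> carrier G" "v x = v y" for x y
    using subgroup.rcos_module_rev[OF assms(1) group_axioms that(1,2) assms(3)[OF that]]
      that(1) assms(1) by (rule repr_independence)
  have "(\<lambda>x. H #> x) ` carrier G \<subseteq> (\<lambda>z. H #> inv_into (carrier G) v z) ` v ` carrier G"
  proof
    fix C assume "C \<in> (\<lambda>x. H #> x) ` carrier G"
    then obtain x where x: "x \<in> carrier G" "C = H #> x" by blast
    then have "C = H #> inv_into (carrier G) v (v x)"
      using eq[OF x(1), of "inv_into (carrier G) v (v x)"]
      by (metis f_inv_into_f image_eqI inv_into_into)
    then show "C \<in> (\<lambda>z. H #> inv_into (carrier G) v z) ` v ` carrier G"
      using x(1) by blast
  qed
  then have "finite ((\<lambda>x. H #> x) ` carrier G)"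
    using assms(2) by (meson finite_imageI finite_subset)
  moreover have "rcosets H = (\<lambda>x. H #> x) ` carrier G"
    by (auto simp: RCOSETS_def)
  ultimately show ?thesis
    using assms(1) by (simp add: finite_index_def)
qed

lemma finite_index_mono:
  assumes "finite_index G H" "H \<subseteq> K" "subgroup K G"
  shows "finite_index G K"
proof (rule finite_indexI[where v = "\<lambda>x. H #> x"])
  have H: "subgroup H G"
    using assms(1) by (simp add: finite_index_def)
  have "(\<lambda>x. H #> x) ` carrier G = rcosets H"
    by (auto simp: RCOSETS_def)
  then show "finite ((\<lambda>x. H #> x) ` carrier G)"
    using assms(1) by (simp add: finite_index_def)
  show "y \<otimes> inv x \<in> K" if "x \<in> carrier G" "y \<in> carrier G" "H #> x = H #> y" for x y
    using subgroup.rcos_module_imp[OF H group_axioms that(1) repr_independenceD[OF H that(2,3)]]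
      assms(2) by blast
qed (use assms in auto)

text \<open>The unit is added to a finite set of representatives, so the coset \<open>H\<close> may
  be represented twice. The covering arguments need \<open>\<one> \<in> T\<close> but not uniqueness
  of representatives.\<close>

lemma finite_index_transversal:
  assumes "finite_index G H"
  obtains T where "finite T" "T \<subseteq> carrier G" "\<one> \<in> T" "carrier G = H <#> T"
proof -
  have H: "subgroup H G" and fin: "finite (rcosets H)"
    using assms by (auto simp: finite_index_def)
  have "rcosets H = (\<lambda>x. H #> x) ` carrier G"
    by (auto simp: RCOSETS_def)
  then obtain C where C: "C \<subseteq> carrier G" "finite C" "rcosets H = (\<lambda>x. H #> x) ` C"
    using fin by (metis finite_subset_image subset_refl)
  show thesis
  proof
    show "finite (insert \<one> C)" "insert \<one> C \<subseteq> carrier G" "\<one> \<in> insert \<one> C"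
      using C by auto
    have "carrier G = \<Union>(rcosets H)"
      by (simp add: rcosets_part_G[OF H])
    also have "\<dots> = H <#> C"
      unfolding C(3) by (auto simp: r_coset_def set_mult_def)
    finally have *: "carrier G = H <#> C" .
    show "carrier G = H <#> insert \<one> C"
    proof
      show "carrier G \<subseteq> H <#> insert \<one> C"
        unfolding * by (auto simp: set_mult_def)
      show "H <#> insert \<one> C \<subseteq> carrier G"
        using C H by (intro set_mult_closed) (auto simp: subgroup.subset)
    qed
  qed
qed

section \<open>FC-centralizers, and bounds for generated subgroups\<close>

text \<open>Conjugation by \<open>h\<close> is multiplicative: the conjugates of a product lie in
  the product of two finite sets, and those of an inverse are the inverses of finitely many
  elements.\<close>

lemma subgroup_FC_centralizer:
  assumes "subgroup H G"
  shows "subgroup (FC_centralizer G H) G"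
proof (rule subgroupI)
  have H: "H \<subseteq> carrier G" "\<one> \<in> H"
    using assms by (auto simp: subgroup.subset subgroup.one_closed)
  show "FC_centralizer G H \<subseteq> carrier G"
    by (auto simp: FC_centralizer_def)
  have "conjugates G H \<one> \<subseteq> {\<one>}"
    using H by (auto simp: conjugates_def)
  then show "FC_centralizer G H \<noteq> {}"
    by (auto simp: FC_centralizer_def intro: finite_subset)
next
  fix a assume a: "a \<in> FC_centralizer G H"
  have "h \<otimes> inv a \<otimes> inv h = inv (h \<otimes> a \<otimes> inv h)" if "h \<in> H" for h
    using that a subgroup.subset[OF assms]
    by (auto simp: FC_centralizer_def inv_mult_group m_assoc)
  then have "conjugates G H (inv a) = m_inv G ` conjugates G H a"
    by (auto simp: conjugates_def image_image)
  then show "inv a \<in> FC_centralizer G H"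
    using a by (auto simp: FC_centralizer_def)
next
  fix a b assume ab: "a \<in> FC_centralizer G H" "b \<in> FC_centralizer G H"
  have "conjugates G H (a \<otimes> b) \<subseteq> (\<lambda>(x, y). x \<otimes> y) ` (conjugates G H a \<times> conjugates G H b)"
  proof
    fix z assume "z \<in> conjugates G H (a \<otimes> b)"
    then obtain h where h: "h \<in> H" "z = h \<otimes> (a \<otimes> b) \<otimes> inv h"
      by (auto simp: conjugates_def)
    have "h \<in> carrier G"
      using h subgroup.subset[OF assms] by auto
    then have "z = (h \<otimes> a \<otimes> inv h) \<otimes> (h \<otimes> b \<otimes> inv h)"
      using h ab by (auto simp: FC_centralizer_def m_assoc inv_solve_left' simp flip: m_assoc[of "inv h" h])
    then show "z \<in> (\<lambda>(x, y). x \<otimes> y) ` (conjugates G H a \<times> conjugates G H b)"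
      using h(1) by (force simp: conjugates_def)
  qed
  then show "a \<otimes> b \<in> FC_centralizer G H"
    using ab by (auto simp: FC_centralizer_def intro: finite_subset)
qed

lemma FC_centralizer_antimono:
  "H \<subseteq> K \<Longrightarrow> FC_centralizer G K \<subseteq> FC_centralizer G H"
  unfolding FC_centralizer_def conjugates_def by (blast intro: finite_subset[OF image_mono])

lemma commutes_generate:
  assumes "F \<subseteq> carrier G" "g \<in> carrier G" "\<And>f. f \<in> F \<Longrightarrow> g \<otimes> f = f \<otimes> g"
    and "x \<in> generate G F"
  shows "g \<otimes> x = x \<otimes> g"
  using assms(4)
proof (induction rule: generate.induct)
  case (inv h)
  then have h: "h \<in> carrier G" "g \<otimes> h = h \<otimes> g"
    using assms by auto
  have "inv h \<otimes> g = inv h \<otimes> (g \<otimes> h) \<otimes> inv h"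
    using h(1) assms(2) by (simp add: m_assoc)
  also have "\<dots> = g \<otimes> inv h"
    unfolding h(2) using h(1) assms(2) by (simp flip: m_assoc)
  finally show ?case ..
next
  case (eng h1 h2)
  then show ?case
    using assms generate_in_carrier[OF assms(1)] by (metis m_assoc)
qed (use assms in auto)

text \<open>The set \<open>M <#> T\<close> need not be a subgroup, but it contains
  \<open>\<one>\<close> and is stable under right multiplication by the generators and their
  inverses: the factor from \<open>M\<close> that a step creates is absorbed on the left. This
  serves both the local finiteness of products and the Schreier argument.\<close>

lemma generate_subset_set_mult:
  assumes M: "subgroup M G" and T: "T \<subseteq> carrier G" "\<one> \<in> T" and F: "F \<subseteq> carrier G"
    and step: "\<And>t f. t \<in> T \<Longrightarrow> f \<in> F \<Longrightarrow> t \<otimes> f \<in> M <#> T \<and> t \<otimes> inv f \<in> M <#> T"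
  shows "generate G F \<subseteq> M <#> T"
proof
  have *: "m \<otimes> t \<otimes> f \<in> M <#> T"
    if mt: "m \<in> M" "t \<in> T" and f: "f \<in> carrier G" "t \<otimes> f \<in> M <#> T" for m t f
  proof -
    obtain m' t' where "m' \<in> M" "t' \<in> T" "t \<otimes> f = m' \<otimes> t'"
      using f(2) by (auto simp: set_mult_def)
    then have "m \<otimes> t \<otimes> f = (m \<otimes> m') \<otimes> t'" "m \<otimes> m' \<in> M"
      using mt f T M by (simp_all add: m_assoc subgroup.mem_carrier subgroup.m_closed subset_iff)
    then show ?thesis
      using \<open>t' \<in> T\<close> by (auto simp: set_mult_def)
  qed
  \<comment> \<open>\<open>x\<close> stays arbitrary because \<open>generate\<close> is closed under
    products of two generated elements; the claim is then used with
    \<open>x = \<one>\<close>.\<close>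
  have **: "x \<otimes> h \<in> M <#> T" if "h \<in> generate G F" "x \<in> M <#> T" for x h
    using that
  proof (induction arbitrary: x rule: generate.induct)
    case one
    moreover have "x \<in> carrier G"
      using one set_mult_closed[OF subgroup.subset[OF M] T(1)] by blast
    ultimately show ?case by simp
  next
    case (incl h)
    then show ?case using step * F by (auto simp: set_mult_def[of _ M T] subset_iff)
  next
    case (inv h)
    then show ?case using step * F by (auto simp: set_mult_def[of _ M T] subset_iff)
  next
    case (eng h1 h2)
    have "x \<in> carrier G"
      using eng.prems set_mult_closed[OF subgroup.subset[OF M] T(1)] by blast
    then show ?case
      using eng generate_in_carrier[OF F] by (metis m_assoc)
  qed
  have "\<one> \<in> M <#> T"
    using T(2) subgroup.one_closed[OF M] by (force simp: set_mult_def)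
  then show "h \<in> M <#> T" if "h \<in> generate G F" for h
    using **[OF that] generate_in_carrier[OF F that] by fastforce
qed

end

section \<open>The locally finite radical\<close>

definition locally_finite :: "('a, 'b) monoid_scheme \<Rightarrow> 'a set \<Rightarrow> bool" where
  "locally_finite G N \<longleftrightarrow> (\<forall>F. finite F \<and> F \<subseteq> N \<longrightarrow> finite (generate G F))"

definition locally_finite_radical :: "('a, 'b) monoid_scheme \<Rightarrow> 'a set" where
  "locally_finite_radical G = \<Union>{N. N \<lhd> G \<and> locally_finite G N}"

context group
begin

text \<open>
  If \<open>f = p f \<otimes> q f\<close> and \<open>T\<close> is the finite subgroup generated by the \<open>q f\<close>, then \<open>generate G F\<close> is
  contained in \<open>M' <#> T\<close>, where \<open>M'\<close> is generated by the finitely many \<open>T\<close>-conjugates of the \<open>p f\<close>.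
\<close>

lemma locally_finite_set_mult:
  assumes M: "M \<lhd> G" "locally_finite G M" and N: "subgroup N G" "locally_finite G N"
  shows "locally_finite G (M <#> N)"
  unfolding locally_finite_def
proof (intro allI impI, elim conjE)
  fix F assume F: "finite F" "F \<subseteq> M <#> N"
  have sub: "subgroup M G" "M \<subseteq> carrier G" "N \<subseteq> carrier G"
    using normal_imp_subgroup[OF M(1)] subgroup.subset[of M G] subgroup.subset[OF N(1)] by auto
  have "\<forall>f\<in>F. \<exists>p q. p \<in> M \<and> q \<in> N \<and> f = p \<otimes> q"
    using F unfolding set_mult_def by blast
  then obtain p q where pq: "\<And>f. f \<in> F \<Longrightarrow> p f \<in> M" "\<And>f. f \<in> F \<Longrightarrow> q f \<in> N"
    "\<And>f. f \<in> F \<Longrightarrow> f = p f \<otimes> q f"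
    by metis
  have pqG: "p f \<in> carrier G" "q f \<in> carrier G" if "f \<in> F" for f
    using that pq sub by auto
  define T where "T = generate G (q ` F)"
  have qF: "q ` F \<subseteq> carrier G" "q ` F \<subseteq> N" "finite (q ` F)"
    using pq pqG F by auto
  have T: "subgroup T G" "finite T"
    using generate_is_subgroup[OF qF(1)] qF N(2) unfolding T_def locally_finite_def by auto
  note T = T subgroup.subset[OF T(1)] subgroup.one_closed[OF T(1)]
  have qT: "q f \<in> T" if "f \<in> F" for f
    using that unfolding T_def by (intro generate.incl) auto
  define E where "E = (\<lambda>(t, f). t \<otimes> p f \<otimes> inv t) ` (T \<times> F)"
  have E: "finite E" "E \<subseteq> M"
    using T F pq normal_invE(2)[OF M(1)] unfolding E_def by auto
  define M' where "M' = generate G E"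
  have M': "subgroup M' G" "finite M'"
    using generate_is_subgroup[OF subset_trans[OF E(2) sub(2)]] E M(2)
    unfolding M'_def locally_finite_def by auto
  have EM': "t \<otimes> p f \<otimes> inv t \<in> M'" if "t \<in> T" "f \<in> F" for t f
    using that unfolding M'_def by (intro generate.incl) (auto simp: E_def)
  have "generate G F \<subseteq> M' <#> T"
  proof (rule generate_subset_set_mult[OF M'(1) T(3,4)])
    show "F \<subseteq> carrier G"
      using F set_mult_closed[OF sub(2,3)] by blast
    fix t f assume tf: "t \<in> T" "f \<in> F"
    have tG: "t \<in> carrier G"
      using tf T by auto
    note G = tG pqG[OF tf(2)]
    have "t \<otimes> (p f \<otimes> q f) = (t \<otimes> p f \<otimes> inv t) \<otimes> (t \<otimes> q f)"
      using G by (simp add: m_assoc inv_solve_left' flip: m_assoc[of "inv t" t])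
    then have 1: "t \<otimes> f = (t \<otimes> p f \<otimes> inv t) \<otimes> (t \<otimes> q f)"
      using pq(3)[OF tf(2)] by simp
    have 2: "t \<otimes> q f \<in> T" "t \<otimes> inv (q f) \<in> T"
      using tf qT by (simp_all add: subgroup.m_closed[OF T(1)] subgroup.m_inv_closed[OF T(1)])
    \<comment> \<open>In \<open>inv f\<close> the factor \<open>inv (q f)\<close> comes first, so
      \<open>inv (p f)\<close> has to be moved to the left past \<open>u\<close> instead of
      \<open>t\<close>. As \<open>u\<close> lies in \<open>T\<close>, the conjugate that arises is
      again among the generators of \<open>M'\<close>.\<close>
    define u where "u = t \<otimes> inv (q f)"
    have u: "u \<in> T" "u \<in> carrier G"
      using 2 T by (auto simp: u_def)
    have "t \<otimes> inv (p f \<otimes> q f) = u \<otimes> inv (p f)"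
      using G by (simp add: u_def m_assoc inv_mult_group)
    also have "\<dots> = inv (u \<otimes> p f \<otimes> inv u) \<otimes> u"
      using G u by (simp add: m_assoc inv_mult_group)
    finally have 3: "t \<otimes> inv f = inv (u \<otimes> p f \<otimes> inv u) \<otimes> u"
      using pq(3)[OF tf(2)] by simp
    have "inv (u \<otimes> p f \<otimes> inv u) \<in> M'"
      using EM'[OF u(1) tf(2)] by (rule subgroup.m_inv_closed[OF M'(1)])
    then show "t \<otimes> f \<in> M' <#> T \<and> t \<otimes> inv f \<in> M' <#> T"
      unfolding 1 3 using EM'[OF tf] 2 u unfolding set_mult_def by blast
  qed
  moreover have "finite (M' <#> T)"
    using M' T by (simp add: set_mult_def)
  ultimately show "finite (generate G F)"
    by (rule finite_subset)
qed

text \<open>The normal locally finite subgroups form a directed family, since \<open>M <#> N\<close>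
  contains both \<open>M\<close> and \<open>N\<close> and is again of this kind. Hence a finite part
  of their union lies in one of them.\<close>

lemma finite_subset_locally_finite_radical:
  assumes "finite F" "F \<subseteq> locally_finite_radical G"
  shows "\<exists>N. N \<lhd> G \<and> locally_finite G N \<and> F \<subseteq> N"
  using assms
proof (induction F rule: finite_induct)
  case empty
  have "generate G F \<subseteq> {\<one>}" if "F \<subseteq> {\<one>}" for F
    using generate_subgroup_incl[OF that triv_subgroup] .
  then have "locally_finite G {\<one>}"
    unfolding locally_finite_def by (meson finite.emptyI finite_insert finite_subset)
  then show ?case
    using one_is_normal by blast
next
  case (insert x F)
  obtain M where M: "M \<lhd> G" "locally_finite G M" "F \<subseteq> M"
    using insert.IH insert.prems by auto
  obtain N where N: "N \<lhd> G" "locally_finite G N" "x \<in> N"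
    using insert.prems by (auto simp: locally_finite_radical_def)
  have sub: "subgroup M G" "subgroup N G"
    using normal_imp_subgroup[OF M(1)] normal_imp_subgroup[OF N(1)] .
  have "M <#> N \<lhd> G"
    using normal_subgroup_set_mult_closed M(1) N(1) .
  moreover have "locally_finite G (M <#> N)"
    using locally_finite_set_mult[OF M(1,2) sub(2) N(2)] .
  moreover have "x \<in> M <#> N"
    using N(3) subgroup.one_closed[OF sub(1)] subgroup.mem_carrier[OF sub(2)]
    by (force simp: set_mult_def)
  moreover have "m \<in> M <#> N" if "m \<in> M" for m
    using that subgroup.one_closed[OF sub(2)] subgroup.mem_carrier[OF sub(1)]
    by (force simp: set_mult_def)
  ultimately show ?case
    using M(3) by (metis insert_subset subset_iff)
qed

lemma locally_finite_locally_finite_radical: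
  "locally_finite G (locally_finite_radical G)"
  using finite_subset_locally_finite_radical unfolding locally_finite_def by meson

text \<open>Each closure property involves at most two elements of the radical, and these share a
  normal locally finite subgroup.\<close>

lemma normal_locally_finite_radical:
  "locally_finite_radical G \<lhd> G"
proof (rule normal_invI)
  let ?R = "locally_finite_radical G"
  have R: "\<exists>N. subgroup N G \<and> N \<lhd> G \<and> N \<subseteq> ?R \<and> F \<subseteq> N" if F: "finite F" "F \<subseteq> ?R" for F
  proof -
    obtain N where N: "N \<lhd> G" "locally_finite G N" "F \<subseteq> N"
      using finite_subset_locally_finite_radical[OF F] by blast
    then have "N \<subseteq> ?R"
      by (auto simp: locally_finite_radical_def)
    then show ?thesis
      using N normal_imp_subgroup[OF N(1)] by blast
  qed
  show "subgroup ?R G"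
  proof (rule subgroupI)
    show "?R \<subseteq> carrier G"
    proof
      fix x assume "x \<in> ?R"
      then obtain N where "subgroup N G" "x \<in> N"
        using R[of "{x}"] by auto
      then show "x \<in> carrier G"
        by (rule subgroup.mem_carrier)
    qed
    obtain N where "subgroup N G" "N \<subseteq> ?R"
      using R[of "{}"] by auto
    then show "?R \<noteq> {}"
      using subgroup.one_closed[of N G] by auto
    fix a assume a: "a \<in> ?R"
    then obtain N where "subgroup N G" "N \<subseteq> ?R" "a \<in> N"
      using R[of "{a}"] by auto
    then show "inv a \<in> ?R"
      using subgroup.m_inv_closed[of N G a] by auto
    fix b assume b: "b \<in> ?R"
    with a obtain N' where "subgroup N' G" "N' \<subseteq> ?R" "a \<in> N'" "b \<in> N'"
      using R[of "{a, b}"] by auto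
    then show "a \<otimes> b \<in> ?R"
      using subgroup.m_closed[of N' G a b] by auto
  qed
  fix x h assume h: "h \<in> ?R" "x \<in> carrier G"
  then obtain N where "N \<lhd> G" "N \<subseteq> ?R" "h \<in> N"
    using R[of "{h}"] by auto
  then show "x \<otimes> h \<otimes> inv x \<in> ?R"
    using normal_invE(2)[of N x h] h(2) by auto
qed

section \<open>The radical in the discrete topology\<close>

text \<open>In a discrete space every set is closed and compactness is finiteness; moreover, a
  subset of \<open>N\<close> generates the same subgroup in \<open>N\<close> as in
  \<open>G\<close>.\<close>

lemma regionally_compact_discrete:
  assumes "subgroup N G"
  shows "regionally_compact (G\<lparr>carrier := N\<rparr>) (discrete_topology N) \<longleftrightarrow> locally_finite G N"
proof -
  have "locally_compact_group (G\<lparr>carrier := N\<rparr>) (discrete_topology N)"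
    using tdlc_group_discrete_topology[OF subgroup_imp_group[OF assms]]
    by (simp add: tdlc_group_def)
  moreover have "generate G F \<subseteq> N" if "F \<subseteq> N" for F
    using generate_subgroup_incl[OF that assms] .
  ultimately show ?thesis
    unfolding regionally_compact_def locally_finite_def relatively_compactin_def
    by (auto simp: generate_consistent[OF _ assms] compactin_discrete_topology
        discrete_topology_closure_of Int_absorb1)
qed

text \<open>The \<open>GREATEST\<close> in \<open>Rad_RC\<close> is attained: the union of all
  competitors is itself a competitor.\<close>

lemma Rad_RC_discrete:
  "Rad_RC G (discrete_topology (carrier G)) = locally_finite_radical G"
proof -
  have eq: "N \<lhd> G \<and> regionally_compact (G\<lparr>carrier := N\<rparr>) (subtopology (discrete_topology (carrier G)) N)
      \<longleftrightarrow> N \<lhd> G \<and> locally_finite G N" for N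
    using regionally_compact_discrete normal_imp_subgroup[of N G] subgroup.subset[of N G]
    by (auto simp: Int_absorb1)
  show ?thesis
    unfolding Rad_RC_def eq
    by (rule Greatest_equality)
      (use normal_locally_finite_radical locally_finite_locally_finite_radical in
        \<open>auto simp: locally_finite_radical_def\<close>)
qed

end

section \<open>Free abelian groups\<close>

text \<open>This has the form of the difference step in \<open>free_Abelian_group_induct\<close>,
  through which two homomorphisms that agree on a basis are compared.\<close>

lemma hom_free_Abelian_group_diff:
  assumes "h \<in> hom (free_Abelian_group S) G" "group G"
    and "Poly_Mapping.keys x \<subseteq> S" "Poly_Mapping.keys y \<subseteq> S"
  shows "h (x - y) = h x \<otimes>\<^bsub>G\<^esub> inv\<^bsub>G\<^esub> h y"
proof -
  interpret group_hom "free_Abelian_group S" G h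
    using assms by (simp add: group_hom_def group_hom_axioms_def)
  have "h (x \<otimes>\<^bsub>free_Abelian_group S\<^esub> inv\<^bsub>free_Abelian_group S\<^esub> y)
      = h x \<otimes>\<^bsub>G\<^esub> h (inv\<^bsub>free_Abelian_group S\<^esub> y)"
    using assms(3,4) by (intro hom_mult G.inv_closed) auto
  also have "h (inv\<^bsub>free_Abelian_group S\<^esub> y) = inv\<^bsub>G\<^esub> h y"
    using assms(4) by (intro hom_inv) auto
  finally have "h (x \<otimes>\<^bsub>free_Abelian_group S\<^esub> inv\<^bsub>free_Abelian_group S\<^esub> y)
      = h x \<otimes>\<^bsub>G\<^esub> inv\<^bsub>G\<^esub> h y" .
  then show ?thesis
    using assms by simp
qed

text \<open>A basis, finite or not, has a subset of \<open>n\<close> elements, and the isomorphism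
  restricts to an embedding of its span.\<close>

lemma free_abelian_of_rank_embedding:
  fixes G :: "('a, 'b) monoid_scheme"
  assumes "free_abelian_of_rank G r" "group G" "enat n \<le> r"
  obtains S :: "'a set" and \<phi> where "finite S" "card S = n"
    "\<phi> \<in> hom (free_Abelian_group S) G" "inj_on \<phi> (carrier (free_Abelian_group S))"
proof -
  obtain S :: "'a set" where S: "G \<cong> free_Abelian_group S"
    and r: "r = (if finite S then enat (card S) else \<infinity>)"
    using assms(1) by (auto simp: free_abelian_of_rank_def)
  obtain \<phi> where \<phi>: "\<phi> \<in> iso (free_Abelian_group S) G"
    using group.iso_sym[OF assms(2) S] by (auto simp: is_iso_def)
  obtain S' where S': "S' \<subseteq> S" "finite S'" "card S' = n"
  proof (cases "finite S")
    case True
    then show thesis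
      using r assms(3) that by (metis enat_ord_simps(1) obtain_subset_with_card_n)
  next
    case False
    then show thesis
      using that infinite_arbitrarily_large by metis
  qed
  have carr: "carrier (free_Abelian_group S') \<subseteq> carrier (free_Abelian_group S)"
    using S' by auto
  show thesis
  proof
    show "\<phi> \<in> hom (free_Abelian_group S') G"
      using \<phi> carr unfolding iso_def hom_def by (auto simp: subset_iff)
    show "inj_on \<phi> (carrier (free_Abelian_group S'))"
      using \<phi> carr unfolding iso_def bij_betw_def by (auto intro: inj_on_subset)
  qed (use S' in auto)
qed

text \<open>The isomorphism turns the power into the multiple by \<open>k\<close> of a formal
  integer combination, which vanishes only if the combination does.\<close>

lemma free_abelian_of_rank_torsion_free:
  assumes "free_abelian_of_rank G r" "group G" "x \<in> carrier G" "x [^]\<^bsub>G\<^esub> (k::nat) = \<one>\<^bsub>G\<^esub>" "k > 0"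
  shows "x = \<one>\<^bsub>G\<^esub>"
proof -
  obtain S :: "'a set" and f where f: "f \<in> iso G (free_Abelian_group S)"
    using assms(1) by (auto simp: free_abelian_of_rank_def is_iso_def)
  interpret group_hom G "free_Abelian_group S" f
    using f assms by (simp add: group_hom_def group_hom_axioms_def iso_def)
  have "frag_cmul (int k) (f x) = 0"
    using hom_nat_pow[OF assms(3), of k] assms(4) by simp
  then have "f x = 0"
    using assms(5) by simp
  then show ?thesis
    using iso_iff f assms(3) by simp
qed

lemma free_abelian_of_rank_commute:
  assumes "free_abelian_of_rank G r" "group G" "x \<in> carrier G" "y \<in> carrier G"
  shows "x \<otimes>\<^bsub>G\<^esub> y = y \<otimes>\<^bsub>G\<^esub> x"
proof -
  obtain S :: "'a set" and f where f: "f \<in> iso G (free_Abelian_group S)"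
    using assms(1) by (auto simp: free_abelian_of_rank_def is_iso_def)
  have "f (x \<otimes>\<^bsub>G\<^esub> y) = f (y \<otimes>\<^bsub>G\<^esub> x)"
    using f assms by (auto simp: iso_def hom_mult[of f G] add.commute)
  moreover have "x \<otimes>\<^bsub>G\<^esub> y \<in> carrier G" "y \<otimes>\<^bsub>G\<^esub> x \<in> carrier G"
    using assms by (simp_all add: group.is_monoid monoid.m_closed)
  ultimately show ?thesis
    using f by (auto simp: iso_def bij_betw_def inj_on_def)
qed

context group
begin

lemma comm_group_generate:
  assumes "F \<subseteq> carrier G" "\<And>x y. x \<in> F \<Longrightarrow> y \<in> F \<Longrightarrow> x \<otimes> y = y \<otimes> x"
  shows "comm_group (G\<lparr>carrier := generate G F\<rparr>)"
proof -
  have "x \<otimes> y = y \<otimes> x" if "x \<in> generate G F" "y \<in> generate G F" for x y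
  proof (rule commutes_generate[OF assms(1) _ _ that(2)])
    show "x \<in> carrier G"
      using that generate_in_carrier[OF assms(1)] by auto
    show "x \<otimes> f = f \<otimes> x" if "f \<in> F" for f
      using commutes_generate[OF assms(1) _ _ \<open>x \<in> generate G F\<close>, of f] that assms by auto
  qed
  then show ?thesis
    using subgroup_imp_group[OF generate_is_subgroup[OF assms(1)]]
    by (intro group.group_comm_groupI) auto
qed

text \<open>
  The homomorphism that sends the basis to the powers \<open>a s [^] K\<close> becomes \<open>K \<cdot> \<phi>\<close> after
  composition with \<open>\<pi>\<close>, hence it is injective.
\<close>

lemma free_abelian_of_rank_generate_powers:
  assumes Q: "group Q" and \<pi>: "\<pi> \<in> hom G Q"
    and \<phi>: "\<phi> \<in> hom (free_Abelian_group S) Q" "inj_on \<phi> (carrier (free_Abelian_group S))"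
    and S: "finite S" and a: "\<And>s. s \<in> S \<Longrightarrow> a s \<in> carrier G"
    and lift: "\<And>s. s \<in> S \<Longrightarrow> \<pi> (a s) = \<phi> (frag_of s)"
    and K: "K > 0"
    and comm: "\<And>s t. s \<in> S \<Longrightarrow> t \<in> S \<Longrightarrow> a s [^] K \<otimes> a t [^] K = a t [^] K \<otimes> a s [^] (K::nat)"
  shows "free_abelian_of_rank (G\<lparr>carrier := generate G ((\<lambda>s. a s [^] K) ` S)\<rparr>) (enat (card S))"
proof -
  let ?F = "free_Abelian_group S"
  define b where "b = (\<lambda>s. a s [^] K)"
  define D where "D = generate G (b ` S)"
  define GD where "GD = G\<lparr>carrier := D\<rparr>"
  have b: "b ` S \<subseteq> carrier G"
    using a by (auto simp: b_def)
  have D: "subgroup D G" "b ` S \<subseteq> D"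
    unfolding D_def using generate_is_subgroup[OF b] by (auto intro: generate.incl)
  interpret GD: comm_group GD
    unfolding GD_def D_def using comm by (intro comm_group_generate[OF b]) (auto simp: b_def)
  have "b ` S \<subseteq> carrier GD"
    using D by (simp add: GD_def)
  then obtain \<psi> where \<psi>: "\<psi> \<in> hom ?F GD" "\<And>s. s \<in> S \<Longrightarrow> \<psi> (frag_of s) = b s"
    by (rule GD.free_Abelian_group_universal) blast
  have \<pi>_D: "\<pi> \<in> hom GD Q"
    using \<pi> subgroup.subset[OF D(1)] unfolding hom_def GD_def by auto
  have h1: "\<pi> \<circ> \<psi> \<in> hom ?F Q"
    using \<psi>(1) \<pi>_D by (rule Group.hom_compose)
  have h2: "\<phi> \<circ> frag_cmul (int K) \<in> hom ?F Q"
  proof (rule Group.hom_compose[OF _ \<phi>(1)])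
    show "frag_cmul (int K) \<in> hom ?F ?F"
      using keys_cmul by (fastforce simp: hom_def frag_cmul_distrib2)
  qed
  \<comment> \<open>Both sides are homomorphisms in \<open>x\<close>, so it suffices to compare them
    on the basis.\<close>
  have eq: "\<pi> (\<psi> x) = \<phi> (frag_cmul (int K) x)" if "Poly_Mapping.keys x \<subseteq> S" for x
  proof -
    have "(\<pi> \<circ> \<psi>) x = (\<phi> \<circ> frag_cmul (int K)) x"
    proof (rule free_Abelian_group_induct[OF that])
      show "(\<pi> \<circ> \<psi>) 0 = (\<phi> \<circ> frag_cmul (int K)) 0"
        using hom_one[OF h1 group_free_Abelian_group Q] hom_one[OF h2 group_free_Abelian_group Q]
        by simp
    next
      fix x y assume "Poly_Mapping.keys x \<subseteq> S" "Poly_Mapping.keys y \<subseteq> S"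
        "(\<pi> \<circ> \<psi>) x = (\<phi> \<circ> frag_cmul (int K)) x" "(\<pi> \<circ> \<psi>) y = (\<phi> \<circ> frag_cmul (int K)) y"
      then show "(\<pi> \<circ> \<psi>) (x - y) = (\<phi> \<circ> frag_cmul (int K)) (x - y)"
        using hom_free_Abelian_group_diff[OF h1 Q, of x y] hom_free_Abelian_group_diff[OF h2 Q, of x y]
        by (simp del: o_apply)
    next
      fix s assume s: "s \<in> S"
      have "\<pi> (b s) = \<phi> (frag_of s) [^]\<^bsub>Q\<^esub> K"
        using hom_nat_pow[OF \<pi> a[OF s] is_group Q, of K] lift[OF s] by (simp add: b_def)
      also have "\<dots> = \<phi> (frag_cmul (int K) (frag_of s))"
        using hom_nat_pow[OF \<phi>(1) _ group_free_Abelian_group Q, of "frag_of s" K] s by simp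
      finally show "(\<pi> \<circ> \<psi>) (frag_of s) = (\<phi> \<circ> frag_cmul (int K)) (frag_of s)"
        using s \<psi>(2) by simp
    qed
    then show ?thesis by simp
  qed
  interpret \<psi>: group_hom ?F GD \<psi>
    using \<psi>(1) by (simp add: group_hom_def group_hom_axioms_def GD.is_group)
  have ker: "x = 0" if x: "Poly_Mapping.keys x \<subseteq> S" "\<psi> x = \<one>" for x
  proof -
    have "\<phi> (frag_cmul (int K) x) = \<phi> 0"
      using eq[OF x(1)] x(2) hom_one[OF \<pi> is_group Q] hom_one[OF \<phi>(1) group_free_Abelian_group Q]
      by simp
    moreover have "Poly_Mapping.keys (frag_cmul (int K) x) \<subseteq> S"
      using x(1) keys_cmul by blast
    ultimately have "frag_cmul (int K) x = 0"
      by (intro inj_onD[OF \<phi>(2)]) auto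
    then show ?thesis
      using K by simp
  qed
  \<comment> \<open>Surjectivity: the image of \<open>\<psi>\<close> is a subgroup that contains the
    generators of \<open>D\<close>.\<close>
  have "generate GD (b ` S) \<subseteq> \<psi> ` carrier ?F"
  proof (rule GD.generate_subgroup_incl)
    show "subgroup (\<psi> ` carrier ?F) GD"
      by (rule \<psi>.img_is_subgroup)
    show "b ` S \<subseteq> \<psi> ` carrier ?F"
    proof (rule image_subsetI)
      fix s assume "s \<in> S"
      then show "b s \<in> \<psi> ` carrier ?F"
        using \<psi>(2)[of s] by (intro image_eqI[of _ _ "frag_of s"]) auto
    qed
  qed
  moreover have "generate GD (b ` S) = D"
    unfolding GD_def using generate_consistent[OF D(2,1)] by (simp add: D_def)
  ultimately have "\<psi> \<in> iso ?F GD"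
    using ker unfolding \<psi>.iso_iff by (simp add: GD_def)
  then have iso: "GD \<cong> ?F"
    using group.iso_sym[OF group_free_Abelian_group] is_isoI by blast
  \<comment> \<open>The definition of rank asks for a basis in the type of \<open>G\<close>, whereas
    \<open>S\<close> may have another type, such as sets of cosets. The image of \<open>S\<close>
    under \<open>b\<close> is a basis of the right type and the same size.\<close>
  have "inj_on b S"
  proof (rule inj_onI)
    fix s t assume st: "s \<in> S" "t \<in> S" "b s = b t"
    have "frag_of s = frag_of t"
      using \<open>\<psi> \<in> iso ?F GD\<close> st \<psi>(2) unfolding iso_def bij_betw_def inj_on_def by auto
    then show "s = t" by (simp add: frag_of_eq)
  qed
  then have "S \<approx> b ` S" "card (b ` S) = card S"
    using inj_on_image_eqpoll_self eqpoll_sym card_image by blast+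
  then have "GD \<cong> free_Abelian_group (b ` S)"
    by (intro iso_trans[OF iso]) (simp add: isomorphic_free_Abelian_groups)
  then show ?thesis
    using S \<open>card (b ` S) = card S\<close> unfolding free_abelian_of_rank_def GD_def D_def b_def
    by (intro exI[of _ "b ` S"]) (auto simp: b_def)
qed

end

section \<open>The bounded conjugacy rank of a discrete group\<close>

text \<open>Reduces a bound on a possibly infinite rank to its finite truncations. The later
  constructions need a finite basis, because a common exponent exists only for finitely many
  elements.\<close>

lemma enat_le_if_finite_le:
  assumes "\<And>n. enat n \<le> r \<Longrightarrow> enat n \<le> s"
  shows "r \<le> s"
proof (cases r)
  case infinity
  then have "enat (Suc n) \<le> s" for n
    using assms by simp
  then show ?thesis
    by (cases s) (auto, metis Suc_n_not_le_n)
qed (use assms in auto)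

context group
begin

section \<open>Powers that commute and powers in the FC-center\<close>

lemma finitely_generated_generate:
  assumes "finite F" "F \<subseteq> carrier G"
  shows "finitely_generated (G\<lparr>carrier := generate G F\<rparr>)"
  using assms generate_consistent[OF _ generate_is_subgroup[OF assms(2)], of F]
  unfolding finitely_generated_def by (auto intro!: exI[of _ F] intro: generate.incl)

lemma finitely_generated_subgroupE:
  assumes "finitely_generated (G\<lparr>carrier := A\<rparr>)" "subgroup A G"
  obtains F where "finite F" "F \<subseteq> A" "generate G F = A"
  using assms generate_consistent[OF _ assms(2)] that unfolding finitely_generated_def by auto

text \<open>Two exponents are multiplied. The first, \<open>k\<close>, moves all elements into the
  FC-centralizer of \<open>A\<close>; then each \<open>b t\<close> has finitely many conjugates
  under \<open>A\<close>, so a second exponent \<open>l\<close> makes every \<open>b s [^] l\<close>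
  commute with every \<open>b t\<close>, hence also with \<open>b t [^] l\<close>.\<close>

lemma ex_commuting_powers:
  assumes A: "subgroup A G" "finite_index G (FC_centralizer G A)"
    and S: "finite S" "\<And>s. s \<in> S \<Longrightarrow> a s \<in> A"
  shows "\<exists>K>0. \<forall>s\<in>S. \<forall>t\<in>S. a s [^] K \<otimes> a t [^] K = a t [^] K \<otimes> a s [^] (K::nat)"
proof -
  let ?C = "FC_centralizer G A"
  have C: "subgroup ?C G"
    using subgroup_FC_centralizer[OF A(1)] .
  have a: "a s \<in> carrier G" if "s \<in> S" for s
    using S(2)[OF that] subgroup.mem_carrier[OF A(1)] by blast
  have "\<exists>k>0. \<forall>s\<in>S. a s [^] (k::nat) \<in> ?C"
  proof (rule ex_uniform_exponent[OF S(1)])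
    show "\<exists>k>0. a s [^] (k::nat) \<in> ?C" if "s \<in> S" for s
      using finite_index_pow_mem[OF A(2) a[OF that]] .
    show "a s [^] (k * m) \<in> ?C" if "s \<in> S" "a s [^] k \<in> ?C" for s and k m :: nat
      using subgroup_nat_pow_closed[OF C that(2), of m] a[OF that(1)] by (simp add: nat_pow_pow)
  qed
  then obtain k :: nat where k: "k > 0" "\<And>s. s \<in> S \<Longrightarrow> a s [^] k \<in> ?C" by blast
  define b where "b = (\<lambda>s. a s [^] k)"
  have b: "b s \<in> carrier G" "b s \<in> A" "finite (conjugates G A (b s))" if "s \<in> S" for s
    using k(2)[OF that] subgroup_nat_pow_closed[OF A(1) S(2)[OF that]]
    by (auto simp: b_def FC_centralizer_def)
  have "\<exists>l>0. \<forall>st\<in>S \<times> S. b (fst st) [^] (l::nat) \<otimes> b (snd st) = b (snd st) \<otimes> b (fst st) [^] l"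
  proof (rule ex_uniform_exponent)
    show "finite (S \<times> S)"
      using S(1) by simp
    fix st assume st: "st \<in> S \<times> S"
    then have st': "fst st \<in> S" "snd st \<in> S" by auto
    show "\<exists>l>0. b (fst st) [^] (l::nat) \<otimes> b (snd st) = b (snd st) \<otimes> b (fst st) [^] l"
      using finite_conjugates_pow_commutes[OF b(3)[OF st'(2)] b(1)[OF st'(2)] b(2)[OF st'(1)] A(1)] .
    show "b (fst st) [^] (l * m) \<otimes> b (snd st) = b (snd st) \<otimes> b (fst st) [^] (l * m)"
      if "b (fst st) [^] l \<otimes> b (snd st) = b (snd st) \<otimes> b (fst st) [^] l" for l m :: nat
      using group_commutes_pow[OF that, of m] b(1)[OF st'(1)] b(1)[OF st'(2)]
      by (simp add: nat_pow_pow)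
  qed
  then obtain l :: nat where l: "l > 0"
    "\<And>s t. s \<in> S \<Longrightarrow> t \<in> S \<Longrightarrow> b s [^] l \<otimes> b t = b t \<otimes> b s [^] l" by fastforce
  have "a s [^] (k * l) \<otimes> a t [^] (k * l) = a t [^] (k * l) \<otimes> a s [^] (k * l)"
    if "s \<in> S" "t \<in> S" for s t
    using group_commutes_pow[OF l(2)[OF that, symmetric], of l] b(1)[OF that(1)] b(1)[OF that(2)]
      a[OF that(1)] a[OF that(2)]
    by (simp add: b_def nat_pow_pow)
  then show ?thesis
    using k(1) l(1) by (intro exI[of _ "k * l"]) auto
qed

text \<open>A finite generating set of \<open>A\<close> has only finitely many images under
  conjugation by elements of \<open>G\<close>, so the elements that centralize \<open>A\<close>
  already form a subgroup of finite index.\<close>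

lemma finite_index_FC_centralizer_if_subset_FC_center:
  assumes A: "subgroup A G" "finitely_generated (G\<lparr>carrier := A\<rparr>)" "A \<subseteq> FC_center G"
  shows "finite_index G (FC_centralizer G A)"
proof -
  obtain F where F: "finite F" "F \<subseteq> A" "generate G F = A"
    using finitely_generated_subgroupE[OF A(2,1)] .
  have FG: "F \<subseteq> carrier G"
    using F(2) subgroup.subset[OF A(1)] by blast
  \<comment> \<open>Conjugating by \<open>inv x\<close> suits right cosets: if
    \<open>v x = v y\<close>, then \<open>y \<otimes> inv x\<close> commutes with \<open>F\<close>.
    The restriction makes \<open>v x\<close> an element of the finite product \<open>PiE\<close> of
    conjugacy classes.\<close>
  define v where "v = (\<lambda>x. restrict (\<lambda>f. inv x \<otimes> f \<otimes> x) F)"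
  show ?thesis
  proof (rule finite_indexI[OF subgroup_FC_centralizer[OF A(1)], where v = v])
    have "inv x \<otimes> f \<otimes> x \<in> conjugates G (carrier G) f" if "x \<in> carrier G" for x f
      unfolding conjugates_def using that by (intro image_eqI[of _ _ "inv x"]) auto
    then have "v ` carrier G \<subseteq> (\<Pi>\<^sub>E f\<in>F. conjugates G (carrier G) f)"
      unfolding v_def by auto
    moreover have "finite (\<Pi>\<^sub>E f\<in>F. conjugates G (carrier G) f)"
      using F A(3) by (intro finite_PiE) (auto simp: FC_center_def FC_centralizer_def)
    ultimately show "finite (v ` carrier G)"
      by (rule finite_subset)
  next
    fix x y assume xy: "x \<in> carrier G" "y \<in> carrier G" "v x = v y"
    have "(y \<otimes> inv x) \<otimes> f = f \<otimes> (y \<otimes> inv x)" if f: "f \<in> F" for f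
    proof -
      have fG: "f \<in> carrier G" using f FG by blast
      have "inv x \<otimes> f \<otimes> x = inv y \<otimes> f \<otimes> y"
        using fun_cong[OF xy(3), of f] f by (simp add: v_def)
      then have "y \<otimes> (inv x \<otimes> f \<otimes> x) \<otimes> inv x = y \<otimes> (inv y \<otimes> f \<otimes> y) \<otimes> inv x"
        by simp
      moreover have "y \<otimes> (inv x \<otimes> f \<otimes> x) \<otimes> inv x = (y \<otimes> inv x) \<otimes> f"
        using xy(1,2) fG by (simp add: m_assoc)
      moreover have "y \<otimes> (inv y \<otimes> f \<otimes> y) \<otimes> inv x = f \<otimes> (y \<otimes> inv x)"
        using xy(1,2) fG by (simp flip: m_assoc)
      ultimately show ?thesis by simp
    qed
    then have "(y \<otimes> inv x) \<otimes> h = h \<otimes> (y \<otimes> inv x)" if "h \<in> A" for h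
      using commutes_generate[OF FG, of "y \<otimes> inv x" h] xy that F(3) by auto
    then have "h \<otimes> (y \<otimes> inv x) \<otimes> inv h = y \<otimes> inv x" if "h \<in> A" for h
      using commute_iff_conj_fix[of h "y \<otimes> inv x"] xy that subgroup.mem_carrier[OF A(1) that] by auto
    then have "conjugates G A (y \<otimes> inv x) \<subseteq> {y \<otimes> inv x}"
      by (auto simp: conjugates_def)
    then show "y \<otimes> inv x \<in> FC_centralizer G A"
      using xy by (auto simp: FC_centralizer_def intro: finite_subset)
  qed
qed

text \<open>The argument of Schreier's lemma.\<close>

lemma finitely_generated_in_finite_index:
  assumes "finitely_generated G" "finite_index G C"
  obtains E T where "finite E" "E \<subseteq> C" "finite T" "T \<subseteq> carrier G" "carrier G = generate G E <#> T"
proof -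
  have C: "subgroup C G"
    using assms(2) by (simp add: finite_index_def)
  obtain F where F: "finite F" "F \<subseteq> carrier G" "generate G F = carrier G"
    using assms(1) by (auto simp: finitely_generated_def)
  obtain T where T: "finite T" "T \<subseteq> carrier G" "\<one> \<in> T" "carrier G = C <#> T"
    using finite_index_transversal[OF assms(2)] .
  \<comment> \<open>Whenever \<open>t \<otimes> f = c \<otimes> t'\<close> with
    \<open>c \<in> C\<close>, the element \<open>c\<close> is of this shape and so lies in
    \<open>E\<close>. Inverses of generators are included because the covering lemma treats both
    kinds of factors.\<close>
  define E where "E = (\<lambda>(t, f, t'). t \<otimes> f \<otimes> inv t') ` (T \<times> (F \<union> m_inv G ` F) \<times> T) \<inter> C"
  have E: "finite E" "E \<subseteq> C"
    using T F by (auto simp: E_def)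
  have EG: "E \<subseteq> carrier G"
    using E(2) subgroup.subset[OF C] by blast
  have step: "t \<otimes> f \<in> generate G E <#> T" if "t \<in> T" "f \<in> F \<union> m_inv G ` F" for t f
  proof -
    have tf: "t \<in> carrier G" "f \<in> carrier G"
      using that T(2) F(2) inv_closed by blast+
    then have "t \<otimes> f \<in> C <#> T"
      using T(4) by blast
    then obtain c t' where ct: "c \<in> C" "t' \<in> T" "t \<otimes> f = c \<otimes> t'"
      by (auto simp: set_mult_def)
    have G: "c \<in> carrier G" "t' \<in> carrier G"
      using ct T(2) subgroup.mem_carrier[OF C ct(1)] by auto
    have "t \<otimes> f \<otimes> inv t' = c"
      using G ct(3) by (simp add: m_assoc)
    then have "c \<in> E"
      unfolding E_def using that ct by force
    then show ?thesis
      unfolding ct(3) set_mult_def using ct(2) generate.incl[of c E G] by blast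
  qed
  have M: "subgroup (generate G E) G"
    using generate_is_subgroup[OF EG] .
  have "generate G F \<subseteq> generate G E <#> T"
    using step by (intro generate_subset_set_mult[OF M T(2,3) F(2)]) auto
  moreover have "generate G E <#> T \<subseteq> carrier G"
    using set_mult_closed[OF subgroup.subset[OF M] T(2)] .
  ultimately have "carrier G = generate G E <#> T"
    using F(3) by blast
  then show thesis
    using that E T(1,2) by blast
qed

text \<open>A common power makes each \<open>a s\<close> commute with the finite set
  \<open>E\<close>, hence with the subgroup it generates. As finitely many translates of that
  subgroup cover \<open>G\<close>, the power has finitely many conjugates in
  \<open>G\<close>.\<close>

lemma ex_powers_in_FC_center:
  assumes G: "finitely_generated G"
    and A: "subgroup A G" "finite_index G (FC_centralizer G A)"
    and S: "finite S" "\<And>s. s \<in> S \<Longrightarrow> a s \<in> A"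
  shows "\<exists>K>0. \<forall>s\<in>S. a s [^] (K::nat) \<in> FC_center G"
proof -
  obtain E T where E: "finite E" "E \<subseteq> FC_centralizer G A" and T: "finite T" "T \<subseteq> carrier G"
    and ET: "carrier G = generate G E <#> T"
    using finitely_generated_in_finite_index[OF G A(2)] .
  have a: "a s \<in> carrier G" if "s \<in> S" for s
    using S(2)[OF that] subgroup.mem_carrier[OF A(1)] by blast
  have e: "e \<in> carrier G" "finite (conjugates G A e)" if "e \<in> E" for e
    using E(2) that by (auto simp: FC_centralizer_def)
  then have EG: "E \<subseteq> carrier G" by blast
  have "\<exists>K>0. \<forall>se\<in>S \<times> E. a (fst se) [^] (K::nat) \<otimes> snd se = snd se \<otimes> a (fst se) [^] K"
  proof (rule ex_uniform_exponent)
    show "finite (S \<times> E)"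
      using S(1) E(1) by simp
    fix se assume "se \<in> S \<times> E"
    then have se: "fst se \<in> S" "snd se \<in> E" by auto
    show "\<exists>k>0. a (fst se) [^] (k::nat) \<otimes> snd se = snd se \<otimes> a (fst se) [^] k"
      using finite_conjugates_pow_commutes[OF e(2)[OF se(2)] e(1)[OF se(2)] S(2)[OF se(1)] A(1)] .
    show "a (fst se) [^] (k * m) \<otimes> snd se = snd se \<otimes> a (fst se) [^] (k * m)"
      if "a (fst se) [^] k \<otimes> snd se = snd se \<otimes> a (fst se) [^] k" for k m :: nat
      using group_commutes_pow[OF that, of m] a[OF se(1)] e(1)[OF se(2)] by (simp add: nat_pow_pow)
  qed
  then obtain K :: nat where K: "K > 0"
    "\<And>s e. s \<in> S \<Longrightarrow> e \<in> E \<Longrightarrow> a s [^] K \<otimes> e = e \<otimes> a s [^] K" by fastforce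
  have "a s [^] K \<in> FC_center G" if s: "s \<in> S" for s
  proof -
    define z where "z = a s [^] K"
    have z: "z \<in> carrier G"
      using a[OF s] by (simp add: z_def)
    have zM: "z \<otimes> m = m \<otimes> z" if "m \<in> generate G E" for m
      using commutes_generate[OF EG z _ that] K(2)[OF s] by (auto simp: z_def)
    have "conjugates G (carrier G) z \<subseteq> (\<lambda>t. inv t \<otimes> z \<otimes> t) ` T"
    proof
      fix w assume "w \<in> conjugates G (carrier G) z"
      then obtain h where h: "h \<in> carrier G" "w = h \<otimes> z \<otimes> inv h"
        by (auto simp: conjugates_def)
      \<comment> \<open>It is \<open>inv h\<close>, not \<open>h\<close>, that is decomposed as
        \<open>m \<otimes> t\<close>: then \<open>m\<close> stands next to \<open>z\<close> and
        cancels, and only \<open>t\<close> affects the conjugate.\<close>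
      have "inv h \<in> generate G E <#> T"
        using h(1) ET by blast
      then obtain m t where mt: "m \<in> generate G E" "t \<in> T" "inv h = m \<otimes> t"
        by (auto simp: set_mult_def)
      have G: "m \<in> carrier G" "t \<in> carrier G"
        using mt T generate_in_carrier[OF EG] by auto
      have "h = inv (m \<otimes> t)"
        using h(1) mt(3) by (metis inv_inv)
      then have "w = inv (m \<otimes> t) \<otimes> z \<otimes> (m \<otimes> t)"
        using h(2) mt(3) by simp
      also have "\<dots> = inv t \<otimes> inv m \<otimes> (z \<otimes> m) \<otimes> t"
        using G z by (simp add: m_assoc inv_mult_group)
      also have "\<dots> = inv t \<otimes> inv m \<otimes> (m \<otimes> z) \<otimes> t"
        using zM[OF mt(1)] by simp
      also have "\<dots> = inv t \<otimes> ((inv m \<otimes> m) \<otimes> z) \<otimes> t"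
        using G z by (simp only: m_assoc m_closed inv_closed)
      also have "\<dots> = inv t \<otimes> z \<otimes> t"
        using G z by simp
      finally show "w \<in> (\<lambda>t. inv t \<otimes> z \<otimes> t) ` T"
        using mt(2) by blast
    qed
    then have "finite (conjugates G (carrier G) z)"
      using T(1) by (meson finite_imageI finite_subset)
    then show ?thesis
      using z by (simp add: z_def FC_center_def FC_centralizer_def)
  qed
  then show ?thesis
    using K(1) by blast
qed

section \<open>Thin subgroups and ranks in the discrete topology\<close>

text \<open>The trivial subgroup is compact and open and is normalized by every element; relative
  compactness of conjugates becomes finiteness.\<close>

lemma thin_on_discrete:
  "thin_on G (discrete_topology (carrier G)) A \<longleftrightarrow>
    subgroup A G \<and> finite_index G (FC_centralizer G A)"
proof -
  have eq: "BC_centralizer G (discrete_topology (carrier G)) A = FC_centralizer G A"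
    if A: "subgroup A G"
  proof -
    have "conjugates G A g \<subseteq> carrier G" if "g \<in> carrier G" for g
      using that subgroup.mem_carrier[OF A] by (auto simp: conjugates_def)
    then show ?thesis
      by (auto simp: BC_centralizer_def FC_centralizer_def relatively_compactin_def
          compactin_discrete_topology discrete_topology_closure_of Int_absorb1)
  qed
  have "\<exists>U. subgroup U G \<and> compactin (discrete_topology (carrier G)) U \<and>
      openin (discrete_topology (carrier G)) U \<and> A \<subseteq> normalizer G U" if A: "subgroup A G"
  proof (intro exI conjI)
    show "A \<subseteq> normalizer G {\<one>}"
      using subgroup.subset[OF A]
      by (auto simp: normalizer_def stabilizer_def l_coset_def r_coset_def)
  qed (auto simp: triv_subgroup compactin_discrete_topology)
  then show ?thesis
    unfolding thin_on_def using eq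
    by (auto simp: FC_centralizer_def dest: subgroup.mem_carrier)
qed

lemma compactly_generated_discrete:
  assumes "subgroup A G"
  shows "compactly_generated (G\<lparr>carrier := A\<rparr>) (subtopology (discrete_topology (carrier G)) A)
    \<longleftrightarrow> finitely_generated (G\<lparr>carrier := A\<rparr>)"
  using subgroup.subset[OF assms]
  by (auto simp: compactly_generated_def finitely_generated_def compactin_discrete_topology
      Int_absorb1)

lemma BC_rank_discrete:
  "BC_rank G (discrete_topology (carrier G)) =
    Sup {thin_rank G (discrete_topology (carrier G)) A | A.
      subgroup A G \<and> finitely_generated (G\<lparr>carrier := A\<rparr>) \<and>
      finite_index G (FC_centralizer G A)}"
  unfolding BC_rank_def thin_on_discrete
  by (rule arg_cong[where f = Sup]) (use compactly_generated_discrete in blast)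

lemma thin_rank_discrete:
  assumes "subgroup A G"
  shows "thin_rank G (discrete_topology (carrier G)) A =
    (let Q = G\<lparr>carrier := A\<rparr> Mod locally_finite_radical (G\<lparr>carrier := A\<rparr>)
     in Sup {r. \<exists>B. subgroup B Q \<and> free_abelian_of_rank (Q\<lparr>carrier := B\<rparr>) r})"
  using group.Rad_RC_discrete[OF subgroup_imp_group[OF assms]] subgroup.subset[OF assms]
  by (simp add: thin_rank_def Let_def Int_absorb1)

text \<open>An element of the locally finite radical generates a finite group and so has finite
  order. As \<open>A\<close> is torsion-free, its radical is trivial, and the quotient, a copy of
  \<open>A\<close>, is one of the subgroups counted by the thin rank.\<close>

lemma rank_le_thin_rank_discrete:
  assumes A: "subgroup A G" and r: "free_abelian_of_rank (G\<lparr>carrier := A\<rparr>) r"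
  shows "r \<le> thin_rank G (discrete_topology (carrier G)) A"
proof -
  define H where "H = G\<lparr>carrier := A\<rparr>"
  interpret H: group H
    unfolding H_def using A by (rule subgroup_imp_group)
  let ?R = "locally_finite_radical H"
  interpret R: normal ?R H
    by (rule H.normal_locally_finite_radical)
  have "x = \<one>\<^bsub>H\<^esub>" if "x \<in> ?R" for x
  proof -
    have x: "x \<in> carrier H"
      using that R.subset by blast
    have fin: "finite (generate H {x})"
      using H.locally_finite_locally_finite_radical that by (auto simp: locally_finite_def)
    have "x [^]\<^bsub>H\<^esub> (k::nat) \<in> generate H {x}" for k
      by (induction k) (auto intro: generate.intros)
    then obtain i j :: nat where ij: "i < j" "x [^]\<^bsub>H\<^esub> i = x [^]\<^bsub>H\<^esub> j"
      by (rule ex_less_same_image[OF fin, of "\<lambda>k. x [^]\<^bsub>H\<^esub> k"])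
    then have "x [^]\<^bsub>H\<^esub> (j - i) = \<one>\<^bsub>H\<^esub>" "j - i > 0"
      using H.pow_eq_div2[OF x] by auto
    then show ?thesis
      using free_abelian_of_rank_torsion_free[OF r[folded H_def] H.is_group x] by blast
  qed
  then have R: "?R = {\<one>\<^bsub>H\<^esub>}"
    using R.one_closed by blast
  define Q where "Q = H Mod ?R"
  interpret Q: group Q
    unfolding Q_def by (rule R.factorgroup_is_group)
  define \<pi> where "\<pi> = (\<lambda>x. ?R #>\<^bsub>H\<^esub> x)"
  interpret \<pi>: group_hom H Q \<pi>
    using R.r_coset_hom_Mod by (simp add: group_hom_def group_hom_axioms_def \<pi>_def Q_def
        H.is_group Q.is_group[unfolded Q_def])
  have "\<pi> \<in> iso H Q"
    unfolding \<pi>.iso_iff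
    by (auto simp: \<pi>_def Q_def R r_coset_def FactGroup_def RCOSETS_def)
  then have "Q \<cong> H"
    using H.iso_sym is_isoI by blast
  obtain S :: "'a set" where S: "H \<cong> free_Abelian_group S" "r = (if finite S then enat (card S) else \<infinity>)"
    using r unfolding free_abelian_of_rank_def H_def by blast
  \<comment> \<open>Elements of \<open>Q\<close> are cosets, so a basis for its rank must consist of
    sets; singletons transport \<open>S\<close> into that type.\<close>
  define S' where "S' = (\<lambda>x. {x}) ` S"
  have inj: "inj_on (\<lambda>x. {x}) S"
    by (simp add: inj_on_def)
  have "S \<approx> S'"
    unfolding S'_def using inj_on_image_eqpoll_self[OF inj] eqpoll_sym by blast
  then have "Q \<cong> free_Abelian_group S'"
    by (intro iso_trans[OF \<open>Q \<cong> H\<close> iso_trans[OF S(1)]]) (simp add: isomorphic_free_Abelian_groups)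
  moreover have "r = (if finite S' then enat (card S') else \<infinity>)"
    unfolding S(2) S'_def using inj by (simp add: card_image finite_image_iff)
  ultimately have "free_abelian_of_rank Q r"
    unfolding free_abelian_of_rank_def by blast
  then have "subgroup (carrier Q) Q \<and> free_abelian_of_rank (Q\<lparr>carrier := carrier Q\<rparr>) r"
    using Q.subgroup_self by simp
  then show ?thesis
    unfolding thin_rank_discrete[OF A] H_def[symmetric] Q_def[symmetric] Let_def
    by (intro Sup_upper) blast
qed

section \<open>Construction of free abelian subgroups\<close>

text \<open>\<open>D\<close> is generated by commuting powers of lifts of \<open>n\<close>
  independent elements of the quotient. Since \<open>D\<close> is contained in \<open>A\<close>, its
  FC-centralizer contains that of \<open>A\<close> and keeps finite index.\<close>

lemma ex_free_abelian_lift: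
  assumes A: "subgroup A G" "finite_index G (FC_centralizer G A)"
    and n: "enat n \<le> r" and B: "subgroup B Q" "free_abelian_of_rank (Q\<lparr>carrier := B\<rparr>) r"
    and Q: "Q = G\<lparr>carrier := A\<rparr> Mod N" "N \<lhd> G\<lparr>carrier := A\<rparr>"
  shows "\<exists>D. subgroup D G \<and> finitely_generated (G\<lparr>carrier := D\<rparr>) \<and>
    free_abelian_of_rank (G\<lparr>carrier := D\<rparr>) (enat n) \<and> finite_index G (FC_centralizer G D)"
proof -
  define H where "H = G\<lparr>carrier := A\<rparr>"
  interpret H: group H
    unfolding H_def using A(1) by (rule subgroup_imp_group)
  interpret N: normal N H
    unfolding H_def by (rule Q(2))
  have QH: "Q = H Mod N"
    by (simp add: Q(1) H_def)
  interpret Q: group Q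
    unfolding QH by (rule N.factorgroup_is_group)
  obtain S :: "'a set set" and \<phi> where S: "finite S" "card S = n" and
    \<phi>: "\<phi> \<in> hom (free_Abelian_group S) (Q\<lparr>carrier := B\<rparr>)" "inj_on \<phi> (carrier (free_Abelian_group S))"
    using free_abelian_of_rank_embedding[OF B(2) Q.subgroup_imp_group[OF B(1)] n] .
  have \<phi>Q: "\<phi> \<in> hom (free_Abelian_group S) Q"
    using \<phi>(1) subgroup.subset[OF B(1)] by (auto simp: hom_def)
  define \<pi> where "\<pi> = (\<lambda>x. N #>\<^bsub>H\<^esub> x)"
  have \<pi>: "\<pi> \<in> hom H Q"
    unfolding \<pi>_def QH by (rule N.r_coset_hom_Mod)
  have "\<exists>x\<in>carrier H. \<pi> x = \<phi> (frag_of s)" if "s \<in> S" for s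
  proof -
    have "\<phi> (frag_of s) \<in> carrier Q"
      using hom_in_carrier[OF \<phi>Q, of "frag_of s"] that by simp
    then show ?thesis
      by (auto simp: QH \<pi>_def FactGroup_def RCOSETS_def)
  qed
  then obtain a where a: "\<And>s. s \<in> S \<Longrightarrow> a s \<in> carrier H" "\<And>s. s \<in> S \<Longrightarrow> \<pi> (a s) = \<phi> (frag_of s)"
    by metis
  have aA: "a s \<in> A" if "s \<in> S" for s
    using a(1)[OF that] by (simp add: H_def)
  obtain K :: nat where K: "K > 0"
    "\<And>s t. s \<in> S \<Longrightarrow> t \<in> S \<Longrightarrow> a s [^] K \<otimes> a t [^] K = a t [^] K \<otimes> a s [^] K"
    using ex_commuting_powers[OF A S(1), of a] aA by blast
  define F where "F = (\<lambda>s. a s [^] K) ` S"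
  have F: "finite F" "F \<subseteq> A"
    using S(1) aA subgroup_nat_pow_closed[OF A(1)] by (auto simp: F_def)
  have FG: "F \<subseteq> carrier G"
    using F(2) subgroup.subset[OF A(1)] by blast
  define D where "D = generate G F"
  have D: "subgroup D G" "D \<subseteq> A"
    unfolding D_def using generate_is_subgroup[OF FG] generate_subgroup_incl[OF F(2) A(1)] by auto
  have pow: "x [^]\<^bsub>H\<^esub> K = x [^] K" for x
    unfolding H_def by (rule nat_pow_consistent[symmetric])
  have HD: "H\<lparr>carrier := X\<rparr> = G\<lparr>carrier := X\<rparr>" for X
    by (simp add: H_def)
  have mult: "x \<otimes>\<^bsub>H\<^esub> y = x \<otimes> y" for x y
    by (simp add: H_def)
  \<comment> \<open>The projection \<open>\<pi>\<close> is a homomorphism on \<open>H\<close>, so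
    the construction is carried out there; powers and generated subgroups are then identified with
    those of \<open>G\<close>.\<close>
  have "free_abelian_of_rank (H\<lparr>carrier := generate H ((\<lambda>s. a s [^]\<^bsub>H\<^esub> K) ` S)\<rparr>) (enat (card S))"
    using Q.is_group \<pi> \<phi>Q \<phi>(2) S(1) a K
    by (intro H.free_abelian_of_rank_generate_powers[where \<pi> = \<pi> and \<phi> = \<phi> and Q = Q])
      (auto simp: pow mult)
  moreover have "generate H F = D"
    unfolding H_def D_def using generate_consistent[OF F(2) A(1)] .
  ultimately have "free_abelian_of_rank (G\<lparr>carrier := D\<rparr>) (enat n)"
    using S(2) by (simp add: pow F_def HD)
  moreover have "finitely_generated (G\<lparr>carrier := D\<rparr>)"
    unfolding D_def using finitely_generated_generate[OF F(1) FG] .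
  moreover have "finite_index G (FC_centralizer G D)"
    using finite_index_mono[OF A(2) FC_centralizer_antimono[OF D(2)] subgroup_FC_centralizer[OF D(1)]] .
  ultimately show ?thesis
    using D(1) by blast
qed

text \<open>The power construction with the identity as projection: basis elements of
  \<open>A\<close> already commute, a common power takes them into the FC-center, and the FC-center
  is a subgroup, so it contains what they generate.\<close>

lemma ex_free_abelian_in_FC_center:
  assumes G: "finitely_generated G"
    and A: "subgroup A G" "finite_index G (FC_centralizer G A)"
    and r: "free_abelian_of_rank (G\<lparr>carrier := A\<rparr>) r" "enat n \<le> r"
  shows "\<exists>D. subgroup D G \<and> finitely_generated (G\<lparr>carrier := D\<rparr>) \<and>
    free_abelian_of_rank (G\<lparr>carrier := D\<rparr>) (enat n) \<and> D \<subseteq> FC_center G"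
proof -
  have HA: "group (G\<lparr>carrier := A\<rparr>)"
    using A(1) by (rule subgroup_imp_group)
  obtain S :: "'a set" and \<phi> where S: "finite S" "card S = n" and
    \<phi>: "\<phi> \<in> hom (free_Abelian_group S) (G\<lparr>carrier := A\<rparr>)" "inj_on \<phi> (carrier (free_Abelian_group S))"
    using free_abelian_of_rank_embedding[OF r(1) HA r(2)] .
  have \<phi>G: "\<phi> \<in> hom (free_Abelian_group S) G"
    using \<phi>(1) subgroup.subset[OF A(1)] by (auto simp: hom_def)
  define a where "a = (\<lambda>s. \<phi> (frag_of s))"
  have a: "a s \<in> A" if "s \<in> S" for s
    using hom_in_carrier[OF \<phi>(1), of "frag_of s"] that by (simp add: a_def)
  then have aG: "a s \<in> carrier G" if "s \<in> S" for s
    using that subgroup.mem_carrier[OF A(1)] by blast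
  obtain K :: nat where K: "K > 0" "\<And>s. s \<in> S \<Longrightarrow> a s [^] K \<in> FC_center G"
    using ex_powers_in_FC_center[OF G A S(1), of a] a by blast
  define F where "F = (\<lambda>s. a s [^] K) ` S"
  have F: "finite F" "F \<subseteq> FC_center G" "F \<subseteq> carrier G"
    using S(1) aG K(2) by (auto simp: F_def)
  have comm: "a s [^] K \<otimes> a t [^] K = a t [^] K \<otimes> a s [^] K" if "s \<in> S" "t \<in> S" for s t
    using free_abelian_of_rank_commute[OF r(1) HA, of "a s [^] K" "a t [^] K"]
      subgroup_nat_pow_closed[OF A(1) a] that by simp
  have "id \<in> hom G G"
    by (simp add: hom_def)
  then have "free_abelian_of_rank (G\<lparr>carrier := generate G F\<rparr>) (enat n)"
    unfolding F_def S(2)[symmetric] using \<phi>G \<phi>(2) S(1) aG K(1) comm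
    by (intro free_abelian_of_rank_generate_powers[where \<pi> = id and Q = G and \<phi> = \<phi>])
      (auto simp: a_def is_group)
  moreover have "generate G F \<subseteq> FC_center G"
    unfolding FC_center_def using F(2) subgroup_FC_centralizer[OF subgroup_self]
    by (intro generate_subgroup_incl) (auto simp: FC_center_def)
  ultimately show ?thesis
    using finitely_generated_generate[OF F(1,3)] generate_is_subgroup[OF F(3)] by blast
qed

end

theorem proposition1p4:
  fixes \<Gamma> :: "('a, 'b) monoid_scheme"
  assumes "group \<Gamma>"
  shows "BC_rank \<Gamma> (discrete_topology (carrier \<Gamma>)) =
           Sup {r. \<exists>A. subgroup A \<Gamma> \<and> finitely_generated (\<Gamma>\<lparr>carrier := A\<rparr>) \<and>
                       free_abelian_of_rank (\<Gamma>\<lparr>carrier := A\<rparr>) r \<and>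
                       finite_index \<Gamma> (FC_centralizer \<Gamma> A)}
       \<and> (finitely_generated \<Gamma> \<longrightarrow>
           BC_rank \<Gamma> (discrete_topology (carrier \<Gamma>)) =
           Sup {r. \<exists>A. subgroup A \<Gamma> \<and> finitely_generated (\<Gamma>\<lparr>carrier := A\<rparr>) \<and>
                       free_abelian_of_rank (\<Gamma>\<lparr>carrier := A\<rparr>) r \<and>
                       A \<subseteq> FC_center \<Gamma>})"
proof -
  interpret group \<Gamma> by fact
  let ?X = "{r. \<exists>A. subgroup A \<Gamma> \<and> finitely_generated (\<Gamma>\<lparr>carrier := A\<rparr>) \<and>
    free_abelian_of_rank (\<Gamma>\<lparr>carrier := A\<rparr>) r \<and> finite_index \<Gamma> (FC_centralizer \<Gamma> A)}"
  let ?Y = "{r. \<exists>A. subgroup A \<Gamma> \<and> finitely_generated (\<Gamma>\<lparr>carrier := A\<rparr>) \<and>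
    free_abelian_of_rank (\<Gamma>\<lparr>carrier := A\<rparr>) r \<and> A \<subseteq> FC_center \<Gamma>}"
  have "thin_rank \<Gamma> (discrete_topology (carrier \<Gamma>)) A \<le> Sup ?X"
    if A: "subgroup A \<Gamma>" "finite_index \<Gamma> (FC_centralizer \<Gamma> A)" for A
    unfolding thin_rank_discrete[OF A(1)] Let_def
  \<comment> \<open>A rank \<open>r\<close> in the quotient need not itself be realized in
    \<open>A\<close>, as it may be infinite; each finite \<open>n\<close> below it is realized by a
    finitely generated subgroup.\<close>
  proof (rule Sup_least, rule enat_le_if_finite_le)
    let ?H = "\<Gamma>\<lparr>carrier := A\<rparr>"
    let ?Q = "?H Mod locally_finite_radical ?H"
    fix r n assume "r \<in> {r. \<exists>B. subgroup B ?Q \<and> free_abelian_of_rank (?Q\<lparr>carrier := B\<rparr>) r}" "enat n \<le> r"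
    then obtain B where "subgroup B ?Q" "free_abelian_of_rank (?Q\<lparr>carrier := B\<rparr>) r" "enat n \<le> r"
      by blast
    then have "enat n \<in> ?X"
      using ex_free_abelian_lift[OF A _ _ _ refl
          group.normal_locally_finite_radical[OF subgroup_imp_group[OF A(1)]]] by blast
    then show "enat n \<le> Sup ?X"
      by (rule Sup_upper)
  qed
  then have "BC_rank \<Gamma> (discrete_topology (carrier \<Gamma>)) \<le> Sup ?X"
    unfolding BC_rank_discrete by (intro Sup_least) blast
  moreover have "Sup ?X \<le> BC_rank \<Gamma> (discrete_topology (carrier \<Gamma>))"
  proof (rule Sup_least)
    fix r assume "r \<in> ?X"
    then obtain A where A: "subgroup A \<Gamma>" "finitely_generated (\<Gamma>\<lparr>carrier := A\<rparr>)"
      "free_abelian_of_rank (\<Gamma>\<lparr>carrier := A\<rparr>) r" "finite_index \<Gamma> (FC_centralizer \<Gamma> A)"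
      by blast
    have "r \<le> thin_rank \<Gamma> (discrete_topology (carrier \<Gamma>)) A"
      using rank_le_thin_rank_discrete[OF A(1,3)] .
    also have "\<dots> \<le> BC_rank \<Gamma> (discrete_topology (carrier \<Gamma>))"
      unfolding BC_rank_discrete using A by (intro Sup_upper) blast
    finally show "r \<le> BC_rank \<Gamma> (discrete_topology (carrier \<Gamma>))" .
  qed
  ultimately have 1: "BC_rank \<Gamma> (discrete_topology (carrier \<Gamma>)) = Sup ?X"
    by (rule antisym)
  moreover have "Sup ?X = Sup ?Y" if fg: "finitely_generated \<Gamma>"
  proof (rule antisym)
    show "Sup ?X \<le> Sup ?Y"
    \<comment> \<open>The subgroup \<open>A\<close> need not lie in the FC-center, so it is replaced
      by the subgroup that powers of \<open>n\<close> basis elements generate.\<close>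
    proof (rule Sup_least, rule enat_le_if_finite_le)
      fix r n assume "r \<in> ?X" "enat n \<le> r"
      then have "enat n \<in> ?Y"
        using ex_free_abelian_in_FC_center[OF fg] by blast
      then show "enat n \<le> Sup ?Y"
        by (rule Sup_upper)
    qed
    have "?Y \<subseteq> ?X"
      using finite_index_FC_centralizer_if_subset_FC_center by blast
    then show "Sup ?Y \<le> Sup ?X"
      by (rule Sup_subset_mono)
  qed
  ultimately show ?thesis
    by simp
qed

end
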